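(* Let $A$ be an $m\times m$ real matrix and $0\le n\le m$. Let $\mathbb{X}_n^1$ and $\mathbb{Y}_n^1$ be $n$-dimensional subspaces of $\mathbb{R}^m$ and define $$\mathbb{X}_n^p:=A(\mathbb{Y}_n^{p-1}),\qquad \mathbb{Y}_n^p:=A^T(\mathbb{X}_n^{p-1}),\qquad p=2,3,\ldots.$$ Suppose $\mathbb{X}_n^1$ is optimal for $\mathcal{A}$ and $\mathbb{Y}_n^1$ is optimal for $\mathcal{A}_T$. Then, for all $p\ge2$, the subspaces $\mathbb{X}_n^p$ are optimal for $\mathcal{A}$, and the subspaces $\mathbb{Y}_n^p$ are optimal for $\mathcal{A}_T$ (all with respect to the $n$-width).
   Context: $\|\cdot\|$ is the Euclidean norm. Set $\mathcal{A}:=\{A\mathbf{x}:\mathbf{x}\in\mathbb{R}^m,\ \|\mathbf{x}\|\le1\}$ and $\mathcal{A}_T:=\{A^T\mathbf{x}:\mathbf{x}\in\mathbb{R}^m,\ \|\mathbf{x}\|\le1\}$. For $\mathcal{S}\in\{\mathcal{A},\mathcal{A}_T\}$ and a subspace $\mathbb{X}$ of $\mathbb{R}^m$, $E(\mathcal{S},\mathbb{X}):=\max_{\mathbf{a}\in\mathcal{S}}\min_{\mathbf{x}\in\mathbb{X}}\|\mathbf{a}-\mathbf{x}\|$, and the Kolmogorov $n$-width is $d_n(\mathcal{S}):=\min E(\mathcal{S},\mathbb{X})$ over all $n$-dimensional subspaces $\mathbb{X}$ of $\mathbb{R}^m$. A subspace $\mathbb{X}$ is optimal for $\mathcal{S}$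 (for the $n$-width) if $E(\mathcal{S},\mathbb{X})=d_n(\mathcal{S})$; for $p\ge2$ the spaces $\mathbb{X}_n^p,\mathbb{Y}_n^p$ are allowed to have dimension less than $n$, and optimality still means this equality with the same $n$. $A(\mathbb{Y})$ denotes the image of the subspace $\mathbb{Y}$ under $A$. *)

theory Defs
  imports "HOL-Analysis.Analysis"
begin

definition unit_ball_image :: "real^'m^'m \<Rightarrow> (real^'m) set" where
  "unit_ball_image A = {A *v x | x. norm x \<le> 1}"

text \<open>
  The maximum over \<open>S\<close> and the minimum over \<open>X\<close> are written as \<open>Sup\<close> and \<open>Inf\<close>; the lemmas
  \<open>subspace_Inf_attained\<close> and \<open>subspace_deviation_attained\<close> below show that, for the sets of
  interest, both are attained.
\<close>

definition deviation :: "'a::euclidean_space set \<Rightarrow> 'a set \<Rightarrow> real" where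
  "deviation S X = (SUP a\<in>S. INF x\<in>X. norm (a - x))"

text \<open>
  The infimum is over a nonempty set, bounded below by 0, whenever \<open>n \<le> DIM('a)\<close> and \<open>S\<close> is
  nonempty and compact. An \<open>n\<close>-dimensional subspace at which \<open>deviation\<close> equals \<open>kolmogorov_width\<close>
  is precisely one at which the minimum is attained.
\<close>

definition kolmogorov_width :: "nat \<Rightarrow> 'a::euclidean_space set \<Rightarrow> real" where
  "kolmogorov_width n S = (INF X\<in>{X. subspace X \<and> dim X = n}. deviation S X)"

text \<open>
  The dimension of \<open>X\<close> is deliberately not required to be \<open>n\<close>.
\<close>

definition optimal_subspace :: "nat \<Rightarrow> 'a::euclidean_space set \<Rightarrow> 'a set \<Rightarrow> bool" where
  "optimal_subspace n S X \<longleftrightarrow> subspace X \<and> deviation S X = kolmogorov_width n S"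

lemma subspace_Inf_attained:
  fixes X :: "'a::euclidean_space set"
  assumes "subspace X"
  shows "\<exists>x\<in>X. norm (a - x) = (INF y\<in>X. norm (a - y))"
proof -
  have ne: "X \<noteq> {}" using subspace_0[OF assms] by auto
  obtain x where "x \<in> X" "infdist a X = dist a x"
    using infdist_attains_inf[OF closed_subspace[OF assms] ne] by blast
  then show ?thesis using ne by (auto simp: infdist_notempty dist_norm)
qed

lemma compact_unit_ball_image: "compact (unit_ball_image A)"
proof -
  have "unit_ball_image A = (*v) A ` cball 0 1"
    by (auto simp: unit_ball_image_def)
  then show ?thesis
    by (simp add: compact_continuous_image matrix_vector_mult_linear_continuous_on)
qed

lemma unit_ball_image_nonempty: "unit_ball_image A \<noteq> {}"
  by (auto simp: unit_ball_image_def intro: exI[of _ 0])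

lemma subspace_deviation_attained:
  fixes X :: "'a::euclidean_space set"
  assumes "subspace X" "compact S" "S \<noteq> {}"
  shows "\<exists>a\<in>S. (INF x\<in>X. norm (a - x)) = deviation S X"
proof -
  have ne: "X \<noteq> {}" using subspace_0[OF assms(1)] by auto
  have eq: "(INF x\<in>X. norm (a - x)) = infdist a X" for a
    using ne by (simp add: infdist_notempty dist_norm)
  have "continuous_on S (\<lambda>a. infdist a X)"
    by (intro continuous_intros)
  then obtain a where a: "a \<in> S" "\<forall>b\<in>S. infdist b X \<le> infdist a X"
    using continuous_attains_sup[OF assms(2,3)] by blast
  then have "(SUP b\<in>S. infdist b X) = infdist a X"
    by (intro cSup_eq_maximum) auto
  then show ?thesis using a(1) unfolding deviation_def eq by auto
qed

end

theory Submission
  imports Defs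
begin

text \<open>
  Let \<open>P\<close> be the orthogonal projection onto a subspace \<open>Y\<close>. The deviation of \<open>\<A>\<^sub>T\<close> from \<open>Y\<close> is the
  operator norm of \<open>(I - P)A\<^sup>T\<close>, hence also that of its transpose \<open>A - AP\<close>. Since \<open>AP\<close> maps into
  \<open>A(Y)\<close>, the deviation of \<open>\<A>\<close> from \<open>A(Y)\<close> is no larger. As \<open>A(Y)\<close> has dimension at most \<open>n\<close>, this
  gives \<open>d\<^sub>n(\<A>) \<le> d\<^sub>n(\<A>\<^sub>T)\<close>, and equality by symmetry. So every step \<open>Y \<mapsto> A(Y)\<close> or \<open>X \<mapsto> A\<^sup>T(X)\<close>
  preserves optimality, without any use of singular values.
\<close>

text \<open>Compactness of \<open>S\<close> bounds the distances to \<open>X\<close>, so the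
  supremum is a genuine upper bound, and each infimum is attained. With \<open>deviation_le\<close>,
  this replaces \<open>SUP\<close> and \<open>INF\<close> by explicit approximants.\<close>

lemma deviation_witness:
  assumes "subspace X" "compact S" "a \<in> S"
  obtains x where "x \<in> X" "norm (a - x) \<le> deviation S X"
proof -
  have "X \<noteq> {}" using subspace_0[OF assms(1)] by auto
  then have eq: "(INF x\<in>X. norm (a - x)) = infdist a X" for a
    by (simp add: infdist_notempty dist_norm)
  have "compact ((\<lambda>a. infdist a X) ` S)"
    using assms(2) by (intro compact_continuous_image continuous_intros)
  then have "bdd_above ((\<lambda>a. INF x\<in>X. norm (a - x)) ` S)"
    unfolding eq by (intro bounded_imp_bdd_above compact_imp_bounded)
  then have "(INF x\<in>X. norm (a - x)) \<le> deviation S X"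
    unfolding deviation_def using assms(3) by (intro cSUP_upper)
  then show ?thesis
    using subspace_Inf_attained[OF assms(1), of a] that by metis
qed

lemma deviation_le:
  assumes "S \<noteq> {}" "\<And>a. a \<in> S \<Longrightarrow> \<exists>x\<in>X. norm (a - x) \<le> c"
  shows "deviation S X \<le> c"
  unfolding deviation_def
proof (rule cSUP_least[OF assms(1)])
  fix a assume "a \<in> S"
  then obtain x where "x \<in> X" "norm (a - x) \<le> c"
    using assms(2) by blast
  then show "(INF x\<in>X. norm (a - x)) \<le> c"
    by (intro cINF_lower2[of _ _ x]) (auto intro: bdd_belowI[of _ 0])
qed

lemma deviation_nonneg:
  assumes "subspace X" "compact S" "S \<noteq> {}"
  shows "0 \<le> deviation S X"
proof -
  obtain a where "a \<in> S" using assms(3) by auto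
  then show ?thesis
    using deviation_witness[OF assms(1,2)] by (meson norm_ge_zero order_trans)
qed

text \<open>Extend a basis of \<open>X\<close> to one of the whole space, then keep \<open>n\<close>
  of its vectors, including the original ones.\<close>

lemma subspace_superspace_of_dim:
  fixes X :: "'a::euclidean_space set"
  assumes "subspace X" "dim X \<le> n" "n \<le> DIM('a)"
  obtains Z where "X \<subseteq> Z" "subspace Z" "dim Z = n"
proof -
  obtain B where B: "B \<subseteq> X" "independent B" "X \<subseteq> span B" "card B = dim X"
    using basis_exists by blast
  obtain C where C: "B \<subseteq> C" "independent C" "UNIV \<subseteq> span C"
    using maximal_independent_subset_extend[OF subset_UNIV B(2)] .
  have "card C = DIM('a)"
    using dim_eq_card_independent[OF C(2)] dim_span[of C] C(3)[THEN top.extremum_uniqueI] by simp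
  then obtain D where D: "B \<subseteq> D" "D \<subseteq> C" "card D = n"
    using exists_subset_between[of B n C] B(4) assms(2,3) C(1)
      independent_imp_finite[OF C(2)] by auto
  have "X \<subseteq> span D" using B(3) span_mono[OF D(1)] by blast
  moreover have "dim (span D) = n"
    using D(3) dim_eq_card_independent[OF independent_mono[OF C(2) D(2)]] by simp
  ultimately show ?thesis using that by blast
qed

text \<open>Enlarging \<open>X\<close> to dimension \<open>n\<close> cannot increase its deviation.
  This covers images under \<open>A\<close> whose dimension drops below \<open>n\<close>.\<close>

lemma kolmogorov_width_le_deviation:
  fixes X :: "'a::euclidean_space set"
  assumes "subspace X" "dim X \<le> n" "n \<le> DIM('a)" "compact S" "S \<noteq> {}"
  shows "kolmogorov_width n S \<le> deviation S X"
proof -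
  obtain Z where Z: "X \<subseteq> Z" "subspace Z" "dim Z = n"
    using subspace_superspace_of_dim[OF assms(1-3)] by blast
  have "kolmogorov_width n S \<le> deviation S Z"
    unfolding kolmogorov_width_def using Z assms(4,5)
    by (intro cINF_lower) (auto intro!: bdd_belowI[of _ 0] deviation_nonneg)
  also have "\<dots> \<le> deviation S X"
    using Z(1) deviation_witness[OF assms(1,4)] by (intro deviation_le[OF assms(5)]) blast
  finally show ?thesis .
qed

lemma subspace_matrix_image: "subspace X \<Longrightarrow> subspace ((*v) A ` X)"
  for A :: "real^'n^'m"
  by (rule linear_subspace_image) simp_all

lemma dim_matrix_image_le: "dim ((*v) A ` X) \<le> dim X"
  for A :: "real^'n^'m"
  by (rule dim_image_le) simp

lemma deviation_matrix_image_le: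
  fixes A :: "real^'m^'m"
  assumes "subspace Y"
  shows "deviation (unit_ball_image A) ((*v) A ` Y) \<le> deviation (unit_ball_image (transpose A)) Y"
    (is "_ \<le> ?\<sigma>")
proof (rule deviation_le[OF unit_ball_image_nonempty])
  fix a assume "a \<in> unit_ball_image A"
  then obtain x where x: "a = A *v x" "norm x \<le> 1" by (auto simp: unit_ball_image_def)
  \<comment> \<open>Here \<open>y\<close> is the orthogonal projection of \<open>x\<close> onto
    \<open>Y\<close>. The approximant of \<open>a\<close> will be \<open>A *v y\<close>, with error
    \<open>A *v z\<close>.\<close>
  obtain y z where "y \<in> span Y" and orth: "\<And>w. w \<in> span Y \<Longrightarrow> orthogonal z w" and xyz: "x = y + z"
    using orthogonal_subspace_decomp_exists[of Y x] by blast
  moreover have "span Y = Y" using assms by (simp add: span_eq_iff)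
  ultimately have y: "y \<in> Y" and z: "\<And>w. w \<in> Y \<Longrightarrow> w \<bullet> z = 0"
    by (simp_all add: orthogonal_def inner_commute)
  have "(norm x)\<^sup>2 = (norm y)\<^sup>2 + (norm z)\<^sup>2"
    using z[OF y] xyz by (simp add: norm_add_Pythagorean orthogonal_def)
  then have "norm z \<le> norm x"
    by (simp add: power2_le_imp_le)
  with x(2) have nz: "norm z \<le> 1" by simp
  have "norm (A *v z) \<le> ?\<sigma>"
  proof -
    \<comment> \<open>Pairing with the normalized error recovers its norm; if \<open>A *v z\<close>
      vanishes, \<open>?w\<close> is 0 and the argument still works.\<close>
    let ?w = "sgn (A *v z)"
    have "transpose A *v ?w \<in> unit_ball_image (transpose A)"
      by (auto simp: unit_ball_image_def norm_sgn intro!: exI[of _ ?w])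
    then obtain v where v: "v \<in> Y" "norm (transpose A *v ?w - v) \<le> ?\<sigma>"
      using deviation_witness[OF assms compact_unit_ball_image] by blast
    have "norm (A *v z) = ?w \<bullet> (A *v z)"
      by (simp add: sgn_div_norm dot_square_norm power2_eq_square divide_simps)
    \<comment> \<open>After \<open>A\<close> moves to the other side, \<open>v\<close> can be
      subtracted freely because \<open>z\<close> is orthogonal to \<open>Y\<close>.\<close>
    also have "\<dots> = (transpose A *v ?w - v) \<bullet> z"
      using z[OF v(1)] by (simp add: inner_diff_left dot_lmul_matrix)
    also have "\<dots> \<le> norm (transpose A *v ?w - v) * norm z"
      by (rule norm_cauchy_schwarz)
    also have "\<dots> \<le> ?\<sigma> * 1"
      using v(2) nz by (intro mult_mono) (auto intro: order_trans[OF norm_ge_zero])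
    finally show ?thesis by simp
  qed
  then have "norm (a - A *v y) \<le> ?\<sigma>"
    by (simp add: x(1) xyz matrix_vector_right_distrib)
  with y show "\<exists>u\<in>(*v) A ` Y. norm (a - u) \<le> ?\<sigma>" by blast
qed

lemma kolmogorov_width_transpose_le:
  fixes A :: "real^'m^'m"
  assumes "n \<le> CARD('m)"
  shows "kolmogorov_width n (unit_ball_image A) \<le> kolmogorov_width n (unit_ball_image (transpose A))"
  unfolding kolmogorov_width_def[of n "unit_ball_image (transpose A)"]
proof (rule cINF_greatest)
  \<comment> \<open>Some \<open>n\<close>-dimensional subspace must exist for the infimum to be a
    greatest lower bound.\<close>
  have "n \<le> dim (UNIV :: (real^'m) set)" using assms by simp
  then obtain Z :: "(real^'m) set" where "subspace Z" "dim Z = n"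
    using choose_subspace_of_subspace[of n UNIV] by blast
  then show "{Z :: (real^'m) set. subspace Z \<and> dim Z = n} \<noteq> {}" by blast
next
  fix Y :: "(real^'m) set" assume "Y \<in> {Z. subspace Z \<and> dim Z = n}"
  then have Y: "subspace Y" "dim Y = n" by auto
  have "kolmogorov_width n (unit_ball_image A) \<le> deviation (unit_ball_image A) ((*v) A ` Y)"
    using Y assms dim_matrix_image_le[of A Y]
    by (intro kolmogorov_width_le_deviation)
      (auto intro: subspace_matrix_image compact_unit_ball_image simp: unit_ball_image_nonempty)
  also note deviation_matrix_image_le[OF Y(1)]
  finally show "kolmogorov_width n (unit_ball_image A) \<le> deviation (unit_ball_image (transpose A)) Y" .
qed

lemma kolmogorov_width_transpose:
  fixes A :: "real^'m^'m"
  assumes "n \<le> CARD('m)"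
  shows "kolmogorov_width n (unit_ball_image (transpose A)) = kolmogorov_width n (unit_ball_image A)"
  using kolmogorov_width_transpose_le[OF assms, of A]
    kolmogorov_width_transpose_le[OF assms, of "transpose A"] by simp

text \<open>The image's deviation is squeezed between the equal widths of the two sets. Assuming
  \<open>dim Y \<le> n\<close> rather than equality makes the step iterable.\<close>

lemma optimal_subspace_matrix_image:
  fixes A :: "real^'m^'m"
  assumes "n \<le> CARD('m)" "dim Y \<le> n" "optimal_subspace n (unit_ball_image (transpose A)) Y"
  shows "optimal_subspace n (unit_ball_image A) ((*v) A ` Y)"
proof -
  have Y: "subspace Y"
    and "deviation (unit_ball_image (transpose A)) Y = kolmogorov_width n (unit_ball_image A)"
    using assms(3) kolmogorov_width_transpose[OF assms(1)] by (simp_all add: optimal_subspace_def)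
  then have "deviation (unit_ball_image A) ((*v) A ` Y) \<le> kolmogorov_width n (unit_ball_image A)"
    using deviation_matrix_image_le[OF Y, of A] by simp
  moreover have "kolmogorov_width n (unit_ball_image A) \<le> deviation (unit_ball_image A) ((*v) A ` Y)"
    using Y assms(1,2) dim_matrix_image_le[of A Y]
    by (intro kolmogorov_width_le_deviation)
      (auto intro: subspace_matrix_image compact_unit_ball_image simp: unit_ball_image_nonempty)
  ultimately show ?thesis
    using subspace_matrix_image[OF Y] by (simp add: optimal_subspace_def)
qed

theorem theorem9:
  fixes A :: "real^'m^'m" and n :: nat
    and X Y :: "nat \<Rightarrow> (real^'m) set"
  assumes "n \<le> CARD('m)"
    and "subspace (X 1)" "dim (X 1) = n"
    and "subspace (Y 1)" "dim (Y 1) = n"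
    and "\<And>p. p \<ge> 2 \<Longrightarrow> X p = (*v) A ` Y (p - 1)"
    and "\<And>p. p \<ge> 2 \<Longrightarrow> Y p = (*v) (transpose A) ` X (p - 1)"
    and "optimal_subspace n (unit_ball_image A) (X 1)"
    and "optimal_subspace n (unit_ball_image (transpose A)) (Y 1)"
  shows "\<forall>p\<ge>2. optimal_subspace n (unit_ball_image A) (X p)
           \<and> optimal_subspace n (unit_ball_image (transpose A)) (Y p)"
proof -
  \<comment> \<open>The two recursions cross, so both sequences are treated together, and the
    dimension bounds are carried along for the next step.\<close>
  have "dim (X p) \<le> n \<and> dim (Y p) \<le> n \<and> optimal_subspace n (unit_ball_image A) (X p)
      \<and> optimal_subspace n (unit_ball_image (transpose A)) (Y p)" if "p \<ge> 1" for p
    using that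
  proof (induction p rule: dec_induct)
    case base
    then show ?case using assms(3,5,8,9) by simp
  next
    case (step p)
    have eq: "X (Suc p) = (*v) A ` Y p" "Y (Suc p) = (*v) (transpose A) ` X p"
      using assms(6,7)[of "Suc p"] step.hyps by simp_all
    have "dim (X (Suc p)) \<le> n" "dim (Y (Suc p)) \<le> n"
      using step.IH dim_matrix_image_le[of A "Y p"] dim_matrix_image_le[of "transpose A" "X p"]
      by (simp_all add: eq)
    then show ?case
      using step.IH optimal_subspace_matrix_image[OF assms(1), of "Y p" A]
        optimal_subspace_matrix_image[OF assms(1), of "X p" "transpose A"]
      by (simp add: eq)
  qed
  then show ?thesis by simp
qed

end
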